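(* Let $f:X\to Y$ be a local homeomorphism between second-countable locally compact Hausdorff spaces and let $\mu$ be a regular Borel measure on $Y$. Then there exists a unique regular Borel measure $f^*\mu$ on $X$ such that $f^*\mu(U)=\mu(f(U))$ for all open subsets $U\subset X$ for which $f|_U$ is injective.
   Context: A Borel measure (with values in $[0,\infty]$) is regular if it is inner regular, outer regular and finite on compact sets. *)

theory Defs
  imports "HOL-Analysis.Analysis"
begin

text \<open>
  The library's \<open>borel\<close> belongs to the topology of a type class.  Spaces are rendered here
  as values of type \<^typ>\<open>'a topology\<close>, so the Borel sigma-algebra is taken relative
  to such a value.
\<close>

definition borel_of :: "'a topology \<Rightarrow> 'a measure" where
  "borel_of X = sigma (topspace X) {U. openin X U}"

lemma space_borel_of [simp]: "space (borel_of X) = topspace X"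
  unfolding borel_of_def by (rule space_measure_of) (auto dest: openin_subset)

lemma sets_borel_of: "sets (borel_of X) = sigma_sets (topspace X) {U. openin X U}"
  unfolding borel_of_def by (rule sets_measure_of) (auto dest: openin_subset)

lemma openin_in_sets_borel_of: "openin X U \<Longrightarrow> U \<in> sets (borel_of X)"
  by (simp add: sets_borel_of)

lemma compactin_in_sets_borel_of:
  assumes "Hausdorff_space X" "compactin X K"
  shows "K \<in> sets (borel_of X)"
proof -
  have "closedin X K"
    using assms by (rule compactin_imp_closedin)
  then have "topspace X - (topspace X - K) = K" "openin X (topspace X - K)"
    using closedin_subset by fastforce+
  then show ?thesis
    by (metis openin_in_sets_borel_of sets.compl_sets space_borel_of)
qed

definition inner_regular_measure :: "'a topology \<Rightarrow> 'a measure \<Rightarrow> bool" where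
  "inner_regular_measure X M \<longleftrightarrow>
     (\<forall>A \<in> sets (borel_of X). emeasure M A = (SUP K \<in> {K. compactin X K \<and> K \<subseteq> A}. emeasure M K))"

definition outer_regular_measure :: "'a topology \<Rightarrow> 'a measure \<Rightarrow> bool" where
  "outer_regular_measure X M \<longleftrightarrow>
     (\<forall>A \<in> sets (borel_of X). emeasure M A = (INF U \<in> {U. openin X U \<and> A \<subseteq> U}. emeasure M U))"

definition regular_borel_measure :: "'a topology \<Rightarrow> 'a measure \<Rightarrow> bool" where
  "regular_borel_measure X M \<longleftrightarrow>
     sets M = sets (borel_of X) \<and>
     inner_regular_measure X M \<and> outer_regular_measure X M \<and>
     (\<forall>K. compactin X K \<longrightarrow> emeasure M K < \<infinity>)"

definition local_homeomorphism :: "'a topology \<Rightarrow> 'b topology \<Rightarrow> ('a \<Rightarrow> 'b) \<Rightarrow> bool" where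
  "local_homeomorphism X Y f \<longleftrightarrow>
     (\<forall>x \<in> topspace X. \<exists>U V. openin X U \<and> x \<in> U \<and> openin Y V \<and>
        homeomorphic_map (subtopology X U) (subtopology Y V) f)"

end

theory Submission
  imports Defs
begin

text \<open>
  Cover \<open>X\<close> by countably many open sets \<open>U n\<close> on which \<open>f\<close> is injective and disjointify them
  into Borel pieces \<open>D n\<close>.  The pullback is \<open>A \<mapsto> (\<Sum>n. \<mu> (f ` (A \<inter> D n)))\<close>.  Since \<open>f\<close> restricts to
  a homeomorphism from \<open>U n\<close> onto an open set, compact subsets of \<open>f ` (A \<inter> D n)\<close> and open
  supersets of it lift to \<open>X\<close>, so that regularity is inherited from \<open>\<mu>\<close> piece by piece.
  Uniqueness follows from outer regularity: a Borel subset of \<open>U n\<close> is approximated by open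
  subsets of \<open>U n\<close>, on which the values are prescribed.
\<close>

section \<open>Local homeomorphisms: continuity, openness, local injectivity\<close>

lemma local_homeomorphism_imp_continuous_map:
  assumes "local_homeomorphism X Y f"
  shows "continuous_map X Y f"
proof -
  have "\<exists>U. openin X U \<and> x \<in> U \<and> continuous_map (subtopology X U) Y f"
    if "x \<in> topspace X" for x
    using assms that unfolding local_homeomorphism_def
    by (meson continuous_map_into_fulltopology homeomorphic_imp_continuous_map)
  then have "\<forall>x. \<exists>U. x \<in> topspace X \<longrightarrow>
      openin X U \<and> x \<in> U \<and> continuous_map (subtopology X U) Y f"
    by blast
  then obtain U where U: "\<And>x. x \<in> topspace X \<Longrightarrow>
      openin X (U x) \<and> x \<in> U x \<and> continuous_map (subtopology X (U x)) Y f"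
    by metis
  show ?thesis
  \<comment> \<open>The points of \<open>X\<close> themselves index the cover, and every glued map
    is \<open>f\<close>, so compatibility on overlaps is trivial.\<close>
  proof (rule pasting_lemma[where I = "topspace X" and T = U and f = "\<lambda>_. f"])
    show "\<exists>j. j \<in> topspace X \<and> x \<in> U j \<and> f x = f x" if "x \<in> topspace X" for x
      using U that by blast
  qed (use U in auto)
qed

text \<open>Openness is checked at each point: inside a chart \<open>U\<close>, the image of
  \<open>U \<inter> W\<close> is open in the open set \<open>V\<close>, hence open in
  \<open>Y\<close>.\<close>

lemma local_homeomorphism_imp_open_map:
  assumes "local_homeomorphism X Y f"
  shows "open_map X Y f"
  unfolding open_map_def
proof (intro allI impI)
  fix W assume W: "openin X W"
  show "openin Y (f ` W)"
  proof (subst openin_subopen, safe)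
    fix x assume x: "x \<in> W"
    then have "x \<in> topspace X" using W openin_subset by blast
    then obtain U V where UV: "openin X U" "x \<in> U" "openin Y V"
      "homeomorphic_map (subtopology X U) (subtopology Y V) f"
      using assms unfolding local_homeomorphism_def by blast
    have "openin (subtopology X U) (U \<inter> W)"
      using W by (auto simp: openin_subtopology)
    then have "openin (subtopology Y V) (f ` (U \<inter> W))"
      using UV(4) homeomorphic_imp_open_map open_map_def by blast
    then have "openin Y (f ` (U \<inter> W))"
      using UV(3) openin_trans_full by blast
    then show "\<exists>T. openin Y T \<and> f x \<in> T \<and> T \<subseteq> f ` W"
      using x UV(2) by blast
  qed
qed

lemma local_homeomorphism_locally_inj:
  assumes "local_homeomorphism X Y f" "x \<in> topspace X"
  shows "\<exists>U. openin X U \<and> x \<in> U \<and> inj_on f U"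
proof -
  obtain U V where UV: "openin X U" "x \<in> U"
      "homeomorphic_map (subtopology X U) (subtopology Y V) f"
    using assms unfolding local_homeomorphism_def by blast
  have "inj_on f (topspace (subtopology X U))"
    using UV(3) homeomorphic_eq_everything_map by blast
  then have "inj_on f U"
    using openin_subset[OF UV(1)] by (simp add: Int_absorb1)
  with UV show ?thesis by blast
qed

section \<open>Countable covers by open sets of injectivity\<close>

text \<open>Indexing by \<open>nat\<close> makes \<open>disjointed\<close> applicable, and the empty
  set is allowed as a member. Continuity, openness and injectivity give back the local charts in
  \<open>homeomorphic_on_U\<close>.\<close>

locale injective_open_cover =
  fixes X :: "'a topology" and Y :: "'b topology" and f :: "'a \<Rightarrow> 'b"
    and U :: "nat \<Rightarrow> 'a set"
  assumes cont: "continuous_map X Y f"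
    and opn: "open_map X Y f"
    and open_U: "openin X (U n)"
    and inj_U: "inj_on f (U n)"
    and cover: "(\<Union>n. U n) = topspace X"

text \<open>Second countability enters through the Lindelof property, which thins the cover by all
  open sets of injectivity to a countable one.\<close>

lemma local_homeomorphism_injective_open_cover:
  assumes "second_countable X" "local_homeomorphism X Y f"
  obtains U where "injective_open_cover X Y f U"
proof -
  have "Lindelof_space X"
    using assms(1) by (rule second_countable_imp_Lindelof_space)
  moreover have "\<Union>{U. openin X U \<and> inj_on f U} = topspace X"
    using local_homeomorphism_locally_inj[OF assms(2)] by (auto dest: openin_subset)
  ultimately obtain \<V> where \<V>: "countable \<V>" "\<V> \<subseteq> {U. openin X U \<and> inj_on f U}"
      "\<Union>\<V> = topspace X"
    unfolding Lindelof_space_def by (smt (verit) mem_Collect_eq)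
  \<comment> \<open>Inserting \<open>{}\<close> makes the family nonempty, so that
    \<open>from_nat_into\<close> enumerates exactly it, even if \<open>X\<close> is empty.\<close>
  define U where "U = from_nat_into (insert {} \<V>)"
  have range: "range U = insert {} \<V>"
    unfolding U_def using \<V>(1) by (intro range_from_nat_into) auto
  have "U n \<in> insert {} \<V>" for n
    using range by blast
  then have "openin X (U n) \<and> inj_on f (U n)" for n
    using \<V>(2) by (metis (mono_tags, lifting) inj_on_empty insertE mem_Collect_eq openin_empty subsetD)
  moreover have "(\<Union>n. U n) = topspace X"
    using range \<V>(3) by simp
  ultimately have "injective_open_cover X Y f U"
    using local_homeomorphism_imp_continuous_map[OF assms(2)]
      local_homeomorphism_imp_open_map[OF assms(2)]
    by unfold_locales auto
  then show thesis by (rule that)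
qed

context injective_open_cover
begin

section \<open>The Borel pieces and their images\<close>

abbreviation "D \<equiv> disjointed U"

lemma D_subset: "D n \<subseteq> U n"
  by (rule disjointed_subset)

lemma UN_D: "(\<Union>n. D n) = topspace X"
  using cover by (simp add: UN_disjointed_eq)

lemma inj_D: "inj_on f (A \<inter> D n)"
  using inj_U D_subset by (meson inf_le2 inj_on_subset order_trans)

lemma D_borel [measurable]: "D n \<in> sets (borel_of X)"
proof -
  have "range U \<subseteq> sets (borel_of X)"
    using open_U openin_in_sets_borel_of by blast
  then show ?thesis
    using sets.range_disjointed_sets by blast
qed

text \<open>Induction over the generation of the sigma-algebra. Injectivity on \<open>U n\<close> is
  what makes images commute with complements taken relative to \<open>U n\<close>.\<close>

lemma image_borel_U:
  assumes "A \<in> sets (borel_of X)"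
  shows "f ` (A \<inter> U n) \<in> sets (borel_of Y)"
proof -
  have "A \<in> sigma_sets (topspace X) {U. openin X U}"
    using assms by (simp add: sets_borel_of)
  then show ?thesis
  proof induction
    case (Basic A)
    then have "openin X (A \<inter> U n)" using open_U by auto
    then show ?case using opn open_map_def openin_in_sets_borel_of by metis
  next
    case Empty
    then show ?case by simp
  next
    case (Compl A)
    have "(topspace X - A) \<inter> U n = U n - A \<inter> U n"
      using openin_subset[OF open_U] by blast
    then have "f ` ((topspace X - A) \<inter> U n) = f ` U n - f ` (A \<inter> U n)"
      using inj_on_image_set_diff[OF inj_U[of n], of "U n" "A \<inter> U n"] by auto
    moreover have "f ` U n \<in> sets (borel_of Y)"
      using opn open_U open_map_def openin_in_sets_borel_of by metis
    ultimately show ?case using Compl by auto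
  next
    case (Union A)
    have "f ` ((\<Union>i. A i) \<inter> U n) = (\<Union>i. f ` (A i \<inter> U n))" by blast
    then show ?case using Union by auto
  qed
qed

lemma image_borel:
  assumes "A \<in> sets (borel_of X)"
  shows "f ` (A \<inter> D n) \<in> sets (borel_of Y)"
proof -
  have "A \<inter> D n = (A \<inter> D n) \<inter> U n" using D_subset by blast
  then show ?thesis
    using image_borel_U[of "A \<inter> D n" n] assms D_borel by auto
qed

lemma homeomorphic_on_U:
  "homeomorphic_map (subtopology X (U n)) (subtopology Y (f ` U n)) f"
proof (rule bijective_open_imp_homeomorphic_map)
  have top: "topspace (subtopology X (U n)) = U n"
    using openin_subset[OF open_U] by (simp add: Int_absorb1)
  show "continuous_map (subtopology X (U n)) (subtopology Y (f ` U n)) f"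
    using cont by (auto simp: continuous_map_in_subtopology continuous_map_from_subtopology)
  have fU: "openin Y (f ` U n)"
    using opn open_U unfolding open_map_def by blast
  show "open_map (subtopology X (U n)) (subtopology Y (f ` U n)) f"
    unfolding open_map_def
    using opn open_U fU by (metis image_mono open_map_def openin_open_subtopology)
  show "f ` topspace (subtopology X (U n)) = topspace (subtopology Y (f ` U n))"
    using top openin_subset[OF fU] by (simp add: Int_absorb1)
  show "inj_on f (topspace (subtopology X (U n)))"
    using top inj_U by simp
qed

text \<open>The inverse of the homeomorphism from \<open>U n\<close> onto its image carries
  \<open>L\<close> back to the part of \<open>B\<close> lying over it.\<close>

lemma compact_lift:
  assumes "compactin Y L" "L \<subseteq> f ` B" "B \<subseteq> U n"
  obtains K where "compactin X K" "K \<subseteq> B" "f ` K = L"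
proof
  define K where "K = {x \<in> B. f x \<in> L}"
  show "f ` K = L" "K \<subseteq> B" using assms(2) by (auto simp: K_def)
  then have "K \<subseteq> U n" using assms(3) by blast
  then have "K \<subseteq> topspace (subtopology X (U n))"
    using openin_subset[OF open_U] by auto
  moreover have "compactin (subtopology Y (f ` U n)) (f ` K)"
    using assms \<open>f ` K = L\<close> by (auto simp: compactin_subtopology)
  ultimately have "compactin (subtopology X (U n)) K"
    using homeomorphic_map_compactness[OF homeomorphic_on_U] by blast
  then show "compactin X K" by (simp add: compactin_subtopology)
qed

section \<open>The pullback measure and its values\<close>

text \<open>For a Borel measure \<mu> the sum is the integral over \<open>y\<close> of the number of
  points of \<open>A\<close> in the fibre of \<open>f\<close> over \<open>y\<close>, since each
  \<open>D n\<close> contains at most one point of a fibre.\<close>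

definition pullback :: "'b measure \<Rightarrow> 'a measure" where
  "pullback \<mu> = measure_of (topspace X) (sets (borel_of X)) (\<lambda>A. \<Sum>n. emeasure \<mu> (f ` (A \<inter> D n)))"

lemma sets_pullback [simp]: "sets (pullback \<mu>) = sets (borel_of X)"
  unfolding pullback_def by (metis sets.sets_measure_of_eq space_borel_of)

text \<open>Stated for arbitrary \<open>M\<close> because it serves both the pullback and the
  measures compared with each other in the uniqueness argument.\<close>

lemma decompose:
  assumes "sets M = sets (borel_of X)" "A \<in> sets (borel_of X)"
  shows "emeasure M A = (\<Sum>n. emeasure M (A \<inter> D n))"
proof -
  have "A \<subseteq> topspace X" using sets.sets_into_space[OF assms(2)] by simp
  then have "(\<Union>n. A \<inter> D n) = A" using UN_D by blast
  moreover have "disjoint_family (\<lambda>n. A \<inter> D n)"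
    using disjoint_family_disjointed[of U] by (auto simp: disjoint_family_on_def)
  ultimately show ?thesis
    using suminf_emeasure[of "\<lambda>n. A \<inter> D n" M] assms by (simp add: image_subset_iff sets.Int)
qed

text \<open>On each piece, injectivity keeps images of disjoint sets disjoint, so additivity of
  \<mu> applies; the two summations are then exchanged.\<close>

lemma emeasure_pullback:
  assumes \<mu>: "sets \<mu> = sets (borel_of Y)" and A: "A \<in> sets (borel_of X)"
  shows "emeasure (pullback \<mu>) A = (\<Sum>n. emeasure \<mu> (f ` (A \<inter> D n)))"
  unfolding pullback_def
proof (rule emeasure_measure_of_sigma[OF _ _ _ A])
  show "sigma_algebra (topspace X) (sets (borel_of X))"
    by (metis sets.sigma_algebra_axioms space_borel_of)
  show "positive (sets (borel_of X)) (\<lambda>A. \<Sum>n. emeasure \<mu> (f ` (A \<inter> D n)))"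
    by (simp add: positive_def)
  show "countably_additive (sets (borel_of X)) (\<lambda>A. \<Sum>n. emeasure \<mu> (f ` (A \<inter> D n)))"
    unfolding countably_additive_def
  proof (intro allI impI)
    fix A :: "nat \<Rightarrow> 'a set"
    assume A: "range A \<subseteq> sets (borel_of X)" "disjoint_family A"
    have "(\<Sum>i. emeasure \<mu> (f ` (A i \<inter> D n))) = emeasure \<mu> (f ` ((\<Union>i. A i) \<inter> D n))" for n
    proof -
      have "disjoint_family (\<lambda>i. f ` (A i \<inter> D n))"
        using A(2) inj_onD[OF inj_D[of UNIV n]] by (fastforce simp: disjoint_family_on_def)
      moreover have "range (\<lambda>i. f ` (A i \<inter> D n)) \<subseteq> sets \<mu>"
        using A(1) image_borel \<mu> by blast
      moreover have "(\<Union>i. f ` (A i \<inter> D n)) = f ` ((\<Union>i. A i) \<inter> D n)" by blast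
      ultimately show ?thesis
        using suminf_emeasure[of "\<lambda>i. f ` (A i \<inter> D n)" \<mu>] by simp
    qed
    \<comment> \<open>Tonelli for double series, obtained by reading the sum over \<open>n\<close>
      as an integral against counting measure.\<close>
    moreover have "(\<Sum>i. \<Sum>n. emeasure \<mu> (f ` (A i \<inter> D n))) =
        (\<Sum>n. \<Sum>i. emeasure \<mu> (f ` (A i \<inter> D n)))"
      using nn_integral_suminf[of "\<lambda>n i. emeasure \<mu> (f ` (A i \<inter> D n))" "count_space UNIV"]
      by (simp add: nn_integral_count_space_nat)
    ultimately show "(\<Sum>i. \<Sum>n. emeasure \<mu> (f ` (A i \<inter> D n))) =
        (\<Sum>n. emeasure \<mu> (f ` (\<Union> (range A) \<inter> D n)))"
      by simp
  qed
qed

text \<open>Injectivity on all of \<open>A\<close> makes the images of different pieces disjoint, so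
  the series reassembles to one value of \<mu>. Beyond the open sets of the theorem, this covers the
  compact sets used for inner regularity.\<close>

lemma emeasure_pullback_inj:
  assumes \<mu>: "sets \<mu> = sets (borel_of Y)" and A: "A \<in> sets (borel_of X)" and inj: "inj_on f A"
  shows "emeasure (pullback \<mu>) A = emeasure \<mu> (f ` A)"
proof -
  have "disjoint_family (\<lambda>n. f ` (A \<inter> D n))"
    using disjoint_family_disjointed[of U] inj_onD[OF inj]
    by (fastforce simp: disjoint_family_on_def)
  moreover have "range (\<lambda>n. f ` (A \<inter> D n)) \<subseteq> sets \<mu>"
    using A image_borel \<mu> by blast
  moreover have "(\<Union>n. f ` (A \<inter> D n)) = f ` A"
  proof -
    have "A = (\<Union>n. A \<inter> D n)" using UN_D sets.sets_into_space[OF A] by auto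
    then show ?thesis by (metis image_UN)
  qed
  ultimately show ?thesis
    using suminf_emeasure[of "\<lambda>n. f ` (A \<inter> D n)" \<mu>] emeasure_pullback[OF \<mu> A] by simp
qed

lemma emeasure_pullback_D:
  assumes "sets \<mu> = sets (borel_of Y)" "A \<in> sets (borel_of X)"
  shows "emeasure (pullback \<mu>) (A \<inter> D n) = emeasure \<mu> (f ` (A \<inter> D n))"
  using assms D_borel inj_D by (intro emeasure_pullback_inj) auto

section \<open>Regularity of the pullback\<close>

text \<open>A compact set meets only finitely many pieces, and each contributes at most the finite
  measure of the compact image of \<open>K\<close>.\<close>

lemma pullback_finite_on_compact:
  assumes "Hausdorff_space X" "Hausdorff_space Y" and \<mu>: "sets \<mu> = sets (borel_of Y)"
    and fin: "\<And>K. compactin Y K \<Longrightarrow> emeasure \<mu> K < \<infinity>" and K: "compactin X K"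
  shows "emeasure (pullback \<mu>) K < \<infinity>"
proof -
  have KB: "K \<in> sets (borel_of X)"
    using assms(1) K by (rule compactin_in_sets_borel_of)
  have fK: "compactin Y (f ` K)"
    using K cont by (rule image_compactin)
  have fKB: "f ` K \<in> sets \<mu>"
    using compactin_in_sets_borel_of[OF assms(2) fK] \<mu> by simp
  have "K \<subseteq> \<Union>(range U)" using compactin_subset_topspace[OF K] cover by simp
  then obtain \<F> where "finite \<F>" "\<F> \<subseteq> range U" "K \<subseteq> \<Union>\<F>"
    using compactinD[OF K, of "range U"] open_U by blast
  then obtain J where J: "finite J" "K \<subseteq> (\<Union>n\<in>J. U n)"
    by (metis finite_subset_image)
  \<comment> \<open>An initial segment replaces \<open>J\<close> because \<open>U\<close> and
    \<open>D\<close> have equal unions over \<open>n < N\<close>, but not over arbitrary index sets.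
    The inserted \<open>0\<close> covers an empty \<open>J\<close>.\<close>
  define N where "N = Suc (Max (insert 0 J))"
  have "n < N" if "n \<in> J" for n
    using that J(1) by (simp add: N_def less_Suc_eq_le)
  then have "K \<subseteq> (\<Union>n<N. U n)" using J(2) by blast
  then have KN: "K \<subseteq> (\<Union>n<N. D n)"
    using finite_UN_disjointed_eq[of U N] by (simp add: atLeast0LessThan)
  have "K \<inter> D n = {}" if "n \<ge> N" for n
  proof -
    have "D m \<inter> D n = {}" if "m < N" for m
      using disjoint_family_disjointed[of U] that \<open>n \<ge> N\<close> by (auto simp: disjoint_family_on_def)
    then show ?thesis using KN by blast
  qed
  then have "emeasure (pullback \<mu>) K = (\<Sum>n<N. emeasure \<mu> (f ` (K \<inter> D n)))"
    unfolding emeasure_pullback[OF \<mu> KB] by (intro suminf_finite) (auto simp: not_less)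
  also have "\<dots> \<le> (\<Sum>n<N. emeasure \<mu> (f ` K))"
    by (intro sum_mono emeasure_mono fKB) auto
  also have "\<dots> < \<infinity>"
    using fin[OF fK] by (simp add: ennreal_mult_less_top of_nat_less_top)
  finally show ?thesis .
qed

text \<open>Compact sets approximating the images of the pieces lift to \<open>X\<close>; finite
  disjoint unions of the lifts approximate the partial sums, whose supremum is the measure of
  \<open>A\<close>.\<close>

lemma pullback_inner_regular:
  assumes H: "Hausdorff_space X" and \<mu>: "sets \<mu> = sets (borel_of Y)"
    and reg: "inner_regular_measure Y \<mu>"
  shows "inner_regular_measure X (pullback \<mu>)"
  unfolding inner_regular_measure_def
proof (intro ballI antisym)
  fix A assume A: "A \<in> sets (borel_of X)"
  let ?\<nu> = "pullback \<mu>"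
  let ?S = "SUP K \<in> {K. compactin X K \<and> K \<subseteq> A}. emeasure ?\<nu> K"
  show "?S \<le> emeasure ?\<nu> A"
    using A by (intro SUP_least emeasure_mono) auto
  define C where "C = (\<lambda>n. {K. compactin X K \<and> K \<subseteq> A \<inter> D n})"
  have CB: "K \<in> sets ?\<nu>" if "compactin X K" for K
    using compactin_in_sets_borel_of[OF H that] by simp
  have piece: "emeasure ?\<nu> (A \<inter> D n) \<le> (SUP K \<in> C n. emeasure ?\<nu> K)" for n
  proof -
    have "emeasure ?\<nu> (A \<inter> D n) =
        (SUP L \<in> {L. compactin Y L \<and> L \<subseteq> f ` (A \<inter> D n)}. emeasure \<mu> L)"
      using reg image_borel[OF A] emeasure_pullback_D[OF \<mu> A]
      unfolding inner_regular_measure_def by metis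
    also have "\<dots> \<le> (SUP K \<in> C n. emeasure ?\<nu> K)"
    proof (rule SUP_mono, safe)
      fix L assume L: "compactin Y L" "L \<subseteq> f ` (A \<inter> D n)"
      moreover have "A \<inter> D n \<subseteq> U n" using D_subset by blast
      ultimately obtain K where K: "compactin X K" "K \<subseteq> A \<inter> D n" "f ` K = L"
        by (rule compact_lift)
      have "inj_on f K" using inj_D K(2) by (rule inj_on_subset)
      then have "emeasure ?\<nu> K = emeasure \<mu> L"
        using emeasure_pullback_inj[OF \<mu>] CB K by simp
      then show "\<exists>K\<in>C n. emeasure \<mu> L \<le> emeasure ?\<nu> K"
        using K by (auto simp: C_def)
    qed
    finally show ?thesis .
  qed
  \<comment> \<open>Arguing with suprema in \<open>ennreal\<close> instead of nearly optimal compact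
    sets avoids a separate treatment of infinite values.\<close>
  have partial: "(\<Sum>n<N. emeasure ?\<nu> (A \<inter> D n)) \<le>
      (SUP K \<in> {K. compactin X K \<and> K \<subseteq> A \<inter> (\<Union>n<N. D n)}. emeasure ?\<nu> K)" for N
  proof (induction N)
    case 0
    then show ?case by simp
  next
    case (Suc N)
    let ?P = "\<lambda>N. {K. compactin X K \<and> K \<subseteq> A \<inter> (\<Union>n<N. D n)}"
    \<comment> \<open>Addition may be moved inside a supremum only over a nonempty family; the empty
      set belongs to both.\<close>
    have ne: "?P N \<noteq> {}" "C N \<noteq> {}" by (auto simp: C_def intro!: exI[of _ "{}"])
    have "(\<Sum>n<Suc N. emeasure ?\<nu> (A \<inter> D n)) \<le>
        (SUP K \<in> ?P N. emeasure ?\<nu> K) + (SUP K \<in> C N. emeasure ?\<nu> K)"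
      using Suc piece[of N] by (simp add: add_mono)
    also have "\<dots> = (SUP K \<in> ?P N. SUP L \<in> C N. emeasure ?\<nu> K + emeasure ?\<nu> L)"
      unfolding ennreal_SUP_add_left[OF ne(1), symmetric] ennreal_SUP_add_right[OF ne(2)]
      by (rule SUP_commute)
    also have "\<dots> \<le> (SUP K \<in> ?P (Suc N). emeasure ?\<nu> K)"
    proof (intro SUP_least)
      fix K L assume K: "K \<in> ?P N" and L: "L \<in> C N"
      have "D n \<inter> D N = {}" if "n < N" for n
        using disjoint_family_disjointed[of U] that by (auto simp: disjoint_family_on_def)
      then have "(\<Union>n<N. D n) \<inter> D N = {}" by blast
      moreover have "K \<subseteq> (\<Union>n<N. D n)" "L \<subseteq> D N" using K L by (auto simp: C_def)
      ultimately have "K \<inter> L = {}" by blast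
      then have "emeasure ?\<nu> K + emeasure ?\<nu> L = emeasure ?\<nu> (K \<union> L)"
        using K L CB by (simp add: plus_emeasure C_def)
      moreover have "K \<union> L \<in> ?P (Suc N)"
        using K L by (auto simp: C_def compactin_Un lessThan_Suc)
      ultimately show "emeasure ?\<nu> K + emeasure ?\<nu> L \<le> (SUP K \<in> ?P (Suc N). emeasure ?\<nu> K)"
        by (simp add: SUP_upper)
    qed
    finally show ?case .
  qed
  have "emeasure ?\<nu> A = (SUP N. \<Sum>n<N. emeasure ?\<nu> (A \<inter> D n))"
    using decompose[OF sets_pullback A] by (simp only: suminf_eq_SUP)
  also have "\<dots> \<le> ?S"
    by (intro SUP_least order_trans[OF partial] SUP_subset_mono) auto
  finally show "emeasure ?\<nu> A \<le> ?S" .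
qed

text \<open>Open supersets of the images are pulled back to the sets \<open>U n\<close>, with an
  error on the \<open>n\<close>-th piece small enough for the errors to sum to
  \<open>e\<close>.\<close>

lemma pullback_outer_regular:
  assumes \<mu>: "sets \<mu> = sets (borel_of Y)" and reg: "outer_regular_measure Y \<mu>"
  shows "outer_regular_measure X (pullback \<mu>)"
  unfolding outer_regular_measure_def
proof (intro ballI antisym)
  fix A assume A: "A \<in> sets (borel_of X)"
  let ?\<nu> = "pullback \<mu>"
  let ?I = "INF W \<in> {W. openin X W \<and> A \<subseteq> W}. emeasure ?\<nu> W"
  show "emeasure ?\<nu> A \<le> ?I"
    by (intro INF_greatest emeasure_mono) (auto simp: openin_in_sets_borel_of)
  show "?I \<le> emeasure ?\<nu> A"
  \<comment> \<open>The rule also supplies finiteness of the measure of \<open>A\<close>, without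
    which adding \<open>?d\<close> below would not give a strict inequality.\<close>
  proof (rule ennreal_le_epsilon)
    fix e :: real
    assume fin: "emeasure ?\<nu> A < top" and "0 < e"
    have "\<exists>W. openin X W \<and> A \<inter> D n \<subseteq> W \<and>
        emeasure ?\<nu> W \<le> emeasure ?\<nu> (A \<inter> D n) + ennreal (e * (1/2) ^ Suc n)" for n
    proof -
      let ?B = "f ` (A \<inter> D n)"
      let ?d = "ennreal (e * (1/2) ^ Suc n)"
      have eq: "emeasure ?\<nu> (A \<inter> D n) = emeasure \<mu> ?B"
        using \<mu> A by (rule emeasure_pullback_D)
      have "emeasure ?\<nu> (A \<inter> D n) \<le> emeasure ?\<nu> A"
        using A by (intro emeasure_mono) auto
      then have "emeasure \<mu> ?B < top" using fin eq by simp
      moreover have "0 < ?d" using \<open>0 < e\<close> by simp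
      ultimately have "emeasure \<mu> ?B < emeasure \<mu> ?B + ?d"
        by (simp add: ennreal_add_left_cancel_less)
      moreover have "emeasure \<mu> ?B = (INF V \<in> {V. openin Y V \<and> ?B \<subseteq> V}. emeasure \<mu> V)"
        using reg image_borel[OF A] unfolding outer_regular_measure_def by blast
      ultimately obtain V where V: "openin Y V" "?B \<subseteq> V" "emeasure \<mu> V < emeasure \<mu> ?B + ?d"
        unfolding INF_less_iff by (metis (mono_tags, lifting) INF_less_iff mem_Collect_eq)
      \<comment> \<open>Cutting the preimage down to \<open>U n\<close> keeps \<open>f\<close>
        injective on \<open>W\<close>, so the measure of \<open>W\<close> is that of its image, a
        subset of \<open>V\<close>.\<close>
      define W where "W = U n \<inter> {x \<in> topspace X. f x \<in> V}"
      have W: "openin X W"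
        unfolding W_def using open_U openin_continuous_map_preimage[OF cont V(1)] by blast
      have "inj_on f W" unfolding W_def using inj_U by (rule inj_on_subset) blast
      then have "emeasure ?\<nu> W = emeasure \<mu> (f ` W)"
        using W \<mu> openin_in_sets_borel_of emeasure_pullback_inj by blast
      also have "\<dots> \<le> emeasure \<mu> V"
        using V(1) \<mu> by (intro emeasure_mono) (auto simp: W_def openin_in_sets_borel_of)
      finally have "emeasure ?\<nu> W \<le> emeasure \<mu> ?B + ?d"
        using V(3) by simp
      moreover have "A \<inter> D n \<subseteq> W"
        using V(2) D_subset[of n] sets.sets_into_space[OF A] by (auto simp: W_def)
      ultimately show ?thesis using W eq by metis
    qed
    then obtain W where W: "\<And>n. openin X (W n)" "\<And>n. A \<inter> D n \<subseteq> W n"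
        "\<And>n. emeasure ?\<nu> (W n) \<le> emeasure ?\<nu> (A \<inter> D n) + ennreal (e * (1/2) ^ Suc n)"
      by metis
    have "openin X (\<Union>n. W n)" using W(1) by blast
    moreover have "A \<subseteq> (\<Union>n. W n)"
      using W(2) UN_D sets.sets_into_space[OF A] by fastforce
    ultimately have "?I \<le> emeasure ?\<nu> (\<Union>n. W n)"
      by (intro INF_lower) auto
    also have "\<dots> \<le> (\<Sum>n. emeasure ?\<nu> (W n))"
      using W(1) openin_in_sets_borel_of by (intro emeasure_subadditive_countably) auto
    also have "\<dots> \<le> (\<Sum>n. emeasure ?\<nu> (A \<inter> D n) + ennreal (e * (1/2) ^ Suc n))"
      using W(3) by (intro suminf_le) auto
    also have "\<dots> = (\<Sum>n. emeasure ?\<nu> (A \<inter> D n)) + (\<Sum>n. ennreal (e * (1/2) ^ Suc n))"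
      by (intro suminf_add[symmetric]) auto
    also have "(\<Sum>n. ennreal (e * (1/2) ^ Suc n)) = ennreal e"
      using sums_mult[OF power_half_series, of e] \<open>0 < e\<close>
      by (intro suminf_ennreal_eq) auto
    also have "(\<Sum>n. emeasure ?\<nu> (A \<inter> D n)) = emeasure ?\<nu> A"
      by (rule decompose[OF sets_pullback A, symmetric])
    finally show "?I \<le> emeasure ?\<nu> A + ennreal e" .
  qed
qed

lemma pullback_regular:
  assumes "Hausdorff_space X" "Hausdorff_space Y" "regular_borel_measure Y \<mu>"
  shows "regular_borel_measure X (pullback \<mu>)"
proof -
  have \<mu>: "sets \<mu> = sets (borel_of Y)" "inner_regular_measure Y \<mu>" "outer_regular_measure Y \<mu>"
      "\<And>K. compactin Y K \<Longrightarrow> emeasure \<mu> K < \<infinity>"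
    using assms(3) unfolding regular_borel_measure_def by blast+
  show ?thesis
    unfolding regular_borel_measure_def
    using pullback_inner_regular[OF assms(1) \<mu>(1,2)] pullback_outer_regular[OF \<mu>(1,3)]
      pullback_finite_on_compact[OF assms(1,2) \<mu>(1,4)]
    by simp
qed

section \<open>Uniqueness\<close>

lemma outer_regular_unique:
  assumes sets: "sets M = sets (borel_of X)" "sets N = sets (borel_of X)"
    and reg: "outer_regular_measure X M" "outer_regular_measure X N"
    and eq: "\<And>W. openin X W \<Longrightarrow> inj_on f W \<Longrightarrow> emeasure M W = emeasure N W"
  shows "M = N"
proof (rule measure_eqI)
  show "sets M = sets N" using sets by simp
  \<comment> \<open>Kept one-sided and general in \<open>P\<close> and \<open>Q\<close>, to be used
    in both directions. An open \<open>W\<close> around the piece is shrunk to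
    \<open>W \<inter> U n\<close>, where the measures agree; outer regularity of \<open>Q\<close>
    then gives the infimum over \<open>W\<close>.\<close>
  have le: "emeasure P (A \<inter> D n) \<le> emeasure Q (A \<inter> D n)"
    if A: "A \<in> sets (borel_of X)" and P: "sets P = sets (borel_of X)"
      and Q: "sets Q = sets (borel_of X)" "outer_regular_measure X Q"
      and PQ: "\<And>W. openin X W \<Longrightarrow> inj_on f W \<Longrightarrow> emeasure P W = emeasure Q W"
    for A n and P Q :: "'a measure"
  proof -
    have "emeasure P (A \<inter> D n) \<le> emeasure Q W" if W: "openin X W" "A \<inter> D n \<subseteq> W" for W
    proof -
      have o: "openin X (W \<inter> U n)" using W(1) open_U by blast
      have "emeasure P (A \<inter> D n) \<le> emeasure P (W \<inter> U n)"
        using W(2) D_subset[of n] o P by (intro emeasure_mono) (auto simp: openin_in_sets_borel_of)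
      also have "\<dots> = emeasure Q (W \<inter> U n)"
        using o inj_U[of n] by (intro PQ) (auto intro: inj_on_subset)
      also have "\<dots> \<le> emeasure Q W"
        using W(1) Q(1) by (intro emeasure_mono) (auto simp: openin_in_sets_borel_of)
      finally show ?thesis .
    qed
    then have "emeasure P (A \<inter> D n) \<le> (INF W \<in> {W. openin X W \<and> A \<inter> D n \<subseteq> W}. emeasure Q W)"
      by (intro INF_greatest) auto
    also have "\<dots> = emeasure Q (A \<inter> D n)"
      using Q(2) A D_borel[of n] unfolding outer_regular_measure_def by (metis sets.Int)
    finally show ?thesis .
  qed
  fix A assume "A \<in> sets M"
  then have A: "A \<in> sets (borel_of X)" using sets by simp
  have "emeasure M (A \<inter> D n) = emeasure N (A \<inter> D n)" for n
    using A sets reg eq by (intro antisym le) auto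
  then show "emeasure M A = emeasure N A"
    using decompose[OF sets(1) A] decompose[OF sets(2) A] by simp
qed

end

theorem proposition3p7:
  fixes X :: "'a topology" and Y :: "'b topology" and f :: "'a \<Rightarrow> 'b" and \<mu> :: "'b measure"
  assumes "second_countable X" "locally_compact_space X" "Hausdorff_space X"
    and "second_countable Y" "locally_compact_space Y" "Hausdorff_space Y"
    and "local_homeomorphism X Y f"
    and "regular_borel_measure Y \<mu>"
  shows "\<exists>!\<nu>. regular_borel_measure X \<nu> \<and>
           (\<forall>U. openin X U \<and> inj_on f U \<longrightarrow> emeasure \<nu> U = emeasure \<mu> (f ` U))"
proof -
  obtain U where "injective_open_cover X Y f U"
    using assms(1,7) by (rule local_homeomorphism_injective_open_cover)
  then interpret injective_open_cover X Y f U .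
  have \<mu>: "sets \<mu> = sets (borel_of Y)"
    using assms(8) by (simp add: regular_borel_measure_def)
  show ?thesis
  \<comment> \<open>The witness is built from the chosen cover; uniqueness shows that every such
    cover yields the same measure.\<close>
  proof (rule ex1I[of _ "pullback \<mu>"])
    show pb: "regular_borel_measure X (pullback \<mu>) \<and>
        (\<forall>U. openin X U \<and> inj_on f U \<longrightarrow> emeasure (pullback \<mu>) U = emeasure \<mu> (f ` U))"
      using pullback_regular[OF assms(3,6,8)] emeasure_pullback_inj[OF \<mu>] openin_in_sets_borel_of
      by blast
    fix \<nu> assume "regular_borel_measure X \<nu> \<and>
        (\<forall>U. openin X U \<and> inj_on f U \<longrightarrow> emeasure \<nu> U = emeasure \<mu> (f ` U))"
    with pb show "\<nu> = pullback \<mu>"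
      unfolding regular_borel_measure_def by (intro outer_regular_unique) auto
  qed
qed

end
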